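(* Let $\mathcal G$ be a graph of group actions without self-reverse arcs and let $\Sigma$, $\sim$, $\pi$, $p$ be constructed from $\mathcal G$ by the canonical construction described in the context. Then the graph $\Sigma$ together with the equivalence relation $\sim$ is a scaffolding for $\mathcal G$, witnessed by the maps $\pi$ and $p$.
   Context: **Graphs.** A graph $\Gamma$ has a vertex set $V\Gamma$, an arc set $A\Gamma$, maps $o,t\colon A\Gamma\to V\Gamma$ (origin, terminus) and an involution $a\mapsto\bar a$ on arcs with $o(a)=t(\bar a)$; an arc with $\bar a=a$ is called self-reverse. Graph morphisms preserve $o$, $t$ and reversal; digraphs and digraph morphisms are the same without reversal. $\mathrm{Star}_\Gamma(v)=t^{-1}(v)$. A tree is a connected graph without loops and without two arcs having the same origin and the same terminus, which has no simple cycles of length $\ge 3$. **Group actions.** A permutation group action $(G,X)$ is a faithful action of a group $G$ on a non-empty set $X$. For $Y\subseteq X$, $G^Y$ is the permutation group induced on $Y$ by the setwise stabiliser of $Y$ in $G$. An embedding $(H,Y)\hookrightarrow(G,X)$ is given by an injection $\Phi\colon Y\to X$ such that $h\mapsto \Phi h\Phi^{-1}$ is an isomorphism from $H$ onto $G^{\Phi(Y)}$. **Graph of group actions without self-reverse arcs.** Such a $\mathcal G$ consists of: a connected graph $\Delta$ without self-reverse arcs (base graph); for every $v\in V\Delta$ a permutation group action $(G(v),X(v))$; for every $a\in A\Delta$ a permutation group action $(H(a),Y(a))$ with $(H(\bar a),Y(\bar a))=(H(a),Y(a))$ and an embedding $\Phi_a\colon(H(a),Y(a))\hookrightarrow(G(t(a)),X(t(a)))$.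 An $a$-adhesion map is a map $g\Phi_a\colon Y(a)\to X(t(a))$ with $g\in G(t(a))$; its image is called an $a$-adhesion set. **Scaffolding.** A scaffolding $(\Sigma,\sim,\pi,p)$ for $\mathcal G$ is a graph $\Sigma$ with an equivalence relation $\sim$ on $V\Sigma$, extended to $A\Sigma$ by $a\sim a'$ iff $o(a)\sim o(a')$ and $t(a)\sim t(a')$ (write $[x]$ for the class of $x$ as a set and $\llbracket x\rrbracket$ for the class as a vertex or arc of $T_\Sigma:=\Sigma/\!\sim$), such that: (i) $T_\Sigma$ is a tree; (ii) no arc of $\Sigma$ has both ends in the same class; (iii) $\pi\colon T_\Sigma\to\Delta$ is a graph morphism; (iv) $p$ is a map from $V\Sigma\cup A\Sigma$ to $\bigcup_v X(v)\cup\bigcup_a Y(a)$ such that: $p$ restricts to bijections $[v]\to X(\pi(\llbracket v\rrbracket))$ and $[a]\to Y(\pi(\llbracket a\rrbracket))$; $p(\bar b)=p(b)$ for every arc $b$; the unique map $\Psi_{\llbracket a\rrbracket}\colon Y(\pi(\llbracket a\rrbracket))\to X(\pi(t(\llbracket a\rrbracket)))$ with $\Psi_{\llbracket a\rrbracket}(p(b))=p(t(b))$ for all $b\in[a]$ is a $\pi(\llbracket a\rrbracket)$-adhesion map; and for every vertex $\llbracket v\rrbracket$ of $T_\Sigma$, every $b\in A\Delta$ with $t(b)=\pi(\llbracket v\rrbracket)$ and every $b$-adhesion set $S$, there is exactly one arc $\llbracket a\rrbracket$ of $T_\Sigma$ with $t(\llbracket a\rrbracket)=\llbracket v\rrbracket$,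 $\pi(\llbracket a\rrbracket)=b$ and $\Psi_{\llbracket a\rrbracket}(Y(b))=S$. **Canonical construction.** Let $i(a)$ be the number of distinct $a$-adhesion sets. The augmented base digraph $\Delta_+$ is obtained from the digraph $\Delta$ by adding for each arc $a$ of $\Delta$ $i(a)-1$ new arcs with the same origin and terminus as $a$; $\rho\colon\Delta_+\to\Delta$ is the identity on vertices and maps $a$ and the arcs added because of $a$ to $a$. Let $T$ be a tree and $\pi_+\colon T\to\Delta_+$ a surjective digraph morphism restricting to a bijection $\mathrm{Star}_T(x)\to\mathrm{Star}_{\Delta_+}(\pi_+(x))$ for each $x\in VT$, and such that $\pi:=\rho\pi_+\colon T\to\Delta$ is a graph morphism (such $T,\pi_+$ exist). For each $a\in A\Delta$ fix a bijection between $\rho^{-1}(a)$ and the set of $a$-adhesion sets, with $a$ corresponding to $\Phi_a(Y(a))$, and for each $b\in\rho^{-1}(a)\setminus\{a\}$ fix an $a$-adhesion map $\Phi_b$ whose image is the adhesion set corresponding to $b$. Define $V\Sigma=\bigsqcup_{v\in V\Delta}\pi^{-1}(v)\times X(v)$ and $A\Sigma=\bigsqcup_{a\in A\Delta}\pi^{-1}(a)\times Y(a)$, with $o(a,y)=(o(a),\Phi_{\pi_+(\bar a)}(y))$, $t(a,y)=(t(a),\Phi_{\pi_+(a)}(y))$ and $\overline{(a,y)}=(\bar a,y)$. Two vertices (or two arcs) of $\Sigma$ are $\sim$-equivalent iff their first coordinates are equal, so that $\Sigma/\!\sim$ is identified with $T$ and $\pi$ is viewed as a map $\Sigma/\!\sim\,\to\Delta$.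 Finally $p(s,z)=z$ for all $(s,z)\in V\Sigma\cup A\Sigma$. *)

theory Defs
  imports "Graph_Theory.Digraph_Component" "HOL-Algebra.Group_Action" "HOL-Library.Equipollence"
begin

section \<open>Graphs with arc reversal\<close>

text \<open>
  Digraphs are the records of type \<open>pre_digraph\<close>, with origin map \<open>tail\<close> and terminus map
  \<open>head\<close>. A graph carries in addition the reversal of arcs, which may fix arcs.
\<close>

record ('v, 'a) rgraph = "('v, 'a) pre_digraph" +
  arev :: "'a \<Rightarrow> 'a"

abbreviation digraph_of :: "('v, 'a) rgraph \<Rightarrow> ('v, 'a) pre_digraph" where
  "digraph_of \<Gamma> \<equiv> pre_digraph.truncate \<Gamma>"

definition is_graph :: "('v, 'a) rgraph \<Rightarrow> bool" where
  "is_graph \<Gamma> \<longleftrightarrow> wf_digraph (digraph_of \<Gamma>) \<and>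
     (\<forall>a \<in> arcs \<Gamma>. arev \<Gamma> a \<in> arcs \<Gamma> \<and> arev \<Gamma> (arev \<Gamma> a) = a \<and> tail \<Gamma> a = head \<Gamma> (arev \<Gamma> a))"

definition digraph_morphism ::
  "('v, 'a, 'm) pre_digraph_scheme \<Rightarrow> ('w, 'b, 'n) pre_digraph_scheme \<Rightarrow> ('v \<Rightarrow> 'w) \<Rightarrow> ('a \<Rightarrow> 'b) \<Rightarrow> bool"
  where
  "digraph_morphism \<Gamma> \<Delta> fV fA \<longleftrightarrow>
     fV ` verts \<Gamma> \<subseteq> verts \<Delta> \<and> fA ` arcs \<Gamma> \<subseteq> arcs \<Delta> \<and>
     (\<forall>a \<in> arcs \<Gamma>. tail \<Delta> (fA a) = fV (tail \<Gamma> a) \<and> head \<Delta> (fA a) = fV (head \<Gamma> a))"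

definition graph_morphism ::
  "('v, 'a) rgraph \<Rightarrow> ('w, 'b) rgraph \<Rightarrow> ('v \<Rightarrow> 'w) \<Rightarrow> ('a \<Rightarrow> 'b) \<Rightarrow> bool" where
  "graph_morphism \<Gamma> \<Delta> fV fA \<longleftrightarrow>
     digraph_morphism \<Gamma> \<Delta> fV fA \<and> (\<forall>a \<in> arcs \<Gamma>. arev \<Delta> (fA a) = fA (arev \<Gamma> a))"

text \<open>
  The library's notion \<open>tree\<close> is not usable here, since its \<open>forest\<close> also forbids the closed
  walks consisting of an arc and its reverse. As in the library, connected graphs are non-empty.
\<close>

definition is_tree :: "('v, 'a) rgraph \<Rightarrow> bool" where
  "is_tree \<Gamma> \<longleftrightarrow> is_graph \<Gamma> \<and> connected (digraph_of \<Gamma>) \<and>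
     loopfree_digraph (digraph_of \<Gamma>) \<and> nomulti_digraph (digraph_of \<Gamma>) \<and>
     \<not> (\<exists>c. pre_digraph.cycle (digraph_of \<Gamma>) c \<and> length c \<ge> 3)"


section \<open>Permutation group actions\<close>

record ('g, 'x) perm_action =
  grp :: "'g monoid"
  pts :: "'x set"
  act :: "'g \<Rightarrow> 'x \<Rightarrow> 'x"

definition perm_group_action :: "('g, 'x) perm_action \<Rightarrow> bool" where
  "perm_group_action P \<longleftrightarrow> faithful_action (grp P) (pts P) (act P) \<and> pts P \<noteq> {}"

text \<open>The group \<open>G\<^sup>Z\<close> of permutations of \<open>Z\<close> induced by the setwise stabiliser of \<open>Z\<close>.\<close>

definition induced_group :: "('g, 'x) perm_action \<Rightarrow> 'x set \<Rightarrow> ('x \<Rightarrow> 'x) monoid" where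
  "induced_group P Z = (BijGroup Z)
     \<lparr>carrier := (\<lambda>g. restrict (act P g) Z) ` stabilizer (grp P) (\<lambda>g W. act P g ` W) Z\<rparr>"

definition embedding ::
  "('h, 'y) perm_action \<Rightarrow> ('g, 'x) perm_action \<Rightarrow> ('y \<Rightarrow> 'x) \<Rightarrow> bool" where
  "embedding Q P \<Phi> \<longleftrightarrow> inj_on \<Phi> (pts Q) \<and> \<Phi> ` pts Q \<subseteq> pts P \<and>
     (\<lambda>h. \<lambda>x \<in> \<Phi> ` pts Q. \<Phi> (act Q h (inv_into (pts Q) \<Phi> x)))
       \<in> iso (grp Q) (induced_group P (\<Phi> ` pts Q))"


section \<open>Graphs of group actions without self-reverse arcs\<close>

record ('v, 'a, 'g, 'x, 'h, 'y) action_graph =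
  base :: "('v, 'a) rgraph"
  vact :: "'v \<Rightarrow> ('g, 'x) perm_action"
  aact :: "'a \<Rightarrow> ('h, 'y) perm_action"
  emb :: "'a \<Rightarrow> 'y \<Rightarrow> 'x"

abbreviation X_of :: "('v, 'a, 'g, 'x, 'h, 'y) action_graph \<Rightarrow> 'v \<Rightarrow> 'x set" where
  "X_of \<G> v \<equiv> pts (vact \<G> v)"

abbreviation Y_of :: "('v, 'a, 'g, 'x, 'h, 'y) action_graph \<Rightarrow> 'a \<Rightarrow> 'y set" where
  "Y_of \<G> a \<equiv> pts (aact \<G> a)"

text \<open>
  Actions of \<open>a\<close> and of its reverse need only agree on the carrier of the group; the values
  of \<open>act\<close> elsewhere are irrelevant.
\<close>

definition graph_of_group_actions :: "('v, 'a, 'g, 'x, 'h, 'y) action_graph \<Rightarrow> bool" where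
  "graph_of_group_actions \<G> \<longleftrightarrow>
     is_graph (base \<G>) \<and> connected (digraph_of (base \<G>)) \<and>
     (\<forall>a \<in> arcs (base \<G>). arev (base \<G>) a \<noteq> a) \<and>
     (\<forall>v \<in> verts (base \<G>). perm_group_action (vact \<G> v)) \<and>
     (\<forall>a \<in> arcs (base \<G>). perm_group_action (aact \<G> a) \<and>
        grp (aact \<G> (arev (base \<G>) a)) = grp (aact \<G> a) \<and>
        Y_of \<G> (arev (base \<G>) a) = Y_of \<G> a \<and>
        (\<forall>h \<in> carrier (grp (aact \<G> a)). act (aact \<G> (arev (base \<G>) a)) h = act (aact \<G> a) h) \<and>
        embedding (aact \<G> a) (vact \<G> (head (base \<G>) a)) (emb \<G> a))"

text \<open>Only the values of \<open>f\<close> on \<open>Y(a)\<close> matter in the following definition.\<close>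

definition adhesion_map ::
  "('v, 'a, 'g, 'x, 'h, 'y) action_graph \<Rightarrow> 'a \<Rightarrow> ('y \<Rightarrow> 'x) \<Rightarrow> bool" where
  "adhesion_map \<G> a f \<longleftrightarrow>
     (\<exists>g \<in> carrier (grp (vact \<G> (head (base \<G>) a))).
        \<forall>y \<in> Y_of \<G> a. f y = act (vact \<G> (head (base \<G>) a)) g (emb \<G> a y))"

definition adhesion_sets ::
  "('v, 'a, 'g, 'x, 'h, 'y) action_graph \<Rightarrow> 'a \<Rightarrow> 'x set set" where
  "adhesion_sets \<G> a = {f ` Y_of \<G> a | f. adhesion_map \<G> a f}"


section \<open>Scaffoldings\<close>

definition arc_extension :: "('v, 'a) rgraph \<Rightarrow> 'v rel \<Rightarrow> 'a rel" where
  "arc_extension \<Gamma> R = {(a, a'). a \<in> arcs \<Gamma> \<and> a' \<in> arcs \<Gamma> \<and>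
     (tail \<Gamma> a, tail \<Gamma> a') \<in> R \<and> (head \<Gamma> a, head \<Gamma> a') \<in> R}"

text \<open>
  The images under \<open>R\<close> and \<open>S\<close> below are single classes whenever \<open>R\<close> is an equivalence relation
  on the vertices and \<open>S\<close> its extension to the arcs.
\<close>

definition quotient_graph ::
  "('v, 'a) rgraph \<Rightarrow> 'v rel \<Rightarrow> 'a rel \<Rightarrow> ('v set, 'a set) rgraph" where
  "quotient_graph \<Gamma> R S = \<lparr>
     verts = verts \<Gamma> // R,
     arcs = arcs \<Gamma> // S,
     tail = (\<lambda>A. R `` (tail \<Gamma> ` A)),
     head = (\<lambda>A. R `` (head \<Gamma> ` A)),
     arev = (\<lambda>A. S `` (arev \<Gamma> ` A))\<rparr>"

text \<open>
  The map \<open>\<Psi>\<close> of the arc class \<open>A\<close>, where \<open>Y = p(A)\<close>; \<open>extensional\<close> makes it unique as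
  a HOL function.
\<close>

definition class_map ::
  "('v, 'a) rgraph \<Rightarrow> ('v \<Rightarrow> 'x) \<Rightarrow> ('a \<Rightarrow> 'y) \<Rightarrow> 'y set \<Rightarrow> 'a set \<Rightarrow> 'y \<Rightarrow> 'x" where
  "class_map \<Gamma> pV pA Y A =
     (THE \<Psi>. \<Psi> \<in> extensional Y \<and> (\<forall>b \<in> A. \<Psi> (pA b) = pV (head \<Gamma> b)))"

text \<open>
  \<open>R\<close> and \<open>S\<close> are the relation \<open>\<sim>\<close> on vertices and on arcs; the maps \<open>\<pi>\<close> and \<open>p\<close> are given by
  their restrictions to vertices and to arcs.
\<close>

definition scaffolding ::
  "('v, 'a, 'g, 'x, 'h, 'y) action_graph \<Rightarrow> ('sv, 'sa) rgraph \<Rightarrow> 'sv rel \<Rightarrow> 'sa rel \<Rightarrow>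
   ('sv set \<Rightarrow> 'v) \<Rightarrow> ('sa set \<Rightarrow> 'a) \<Rightarrow> ('sv \<Rightarrow> 'x) \<Rightarrow> ('sa \<Rightarrow> 'y) \<Rightarrow> bool" where
  "scaffolding \<G> \<Gamma> R S \<pi>V \<pi>A pV pA \<longleftrightarrow>
     (let \<Delta> = base \<G>; T = quotient_graph \<Gamma> R S; \<Psi> = (\<lambda>A. class_map \<Gamma> pV pA (Y_of \<G> (\<pi>A A)) A) in
      is_graph \<Gamma> \<and> equiv (verts \<Gamma>) R \<and> S = arc_extension \<Gamma> R \<and>
      is_tree T \<and>
      (\<forall>a \<in> arcs \<Gamma>. (tail \<Gamma> a, head \<Gamma> a) \<notin> R) \<and>
      graph_morphism T \<Delta> \<pi>V \<pi>A \<and>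
      (\<forall>v \<in> verts \<Gamma>. bij_betw pV (R `` {v}) (X_of \<G> (\<pi>V (R `` {v})))) \<and>
      (\<forall>a \<in> arcs \<Gamma>. bij_betw pA (S `` {a}) (Y_of \<G> (\<pi>A (S `` {a})))) \<and>
      (\<forall>b \<in> arcs \<Gamma>. pA (arev \<Gamma> b) = pA b) \<and>
      (\<forall>A \<in> arcs T. adhesion_map \<G> (\<pi>A A) (\<Psi> A)) \<and>
      (\<forall>V \<in> verts T. \<forall>b \<in> arcs \<Delta>. head \<Delta> b = \<pi>V V \<longrightarrow>
         (\<forall>Z \<in> adhesion_sets \<G> b.
            \<exists>!A. A \<in> arcs T \<and> head T A = V \<and> \<pi>A A = b \<and> \<Psi> A ` Y_of \<G> b = Z)))"


section \<open>The canonical construction\<close>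

text \<open>
  The arcs of the augmented base digraph are the arcs \<open>Inl a\<close> of the base graph and the new arcs
  \<open>Inr n\<close> with \<open>n \<in> N\<close>, where \<open>Inr n\<close> is added because of the arc \<open>r n\<close>.
\<close>

definition rho :: "('e \<Rightarrow> 'a) \<Rightarrow> 'a + 'e \<Rightarrow> 'a" where
  "rho r = case_sum id r"

definition augmented_digraph ::
  "('v, 'a) rgraph \<Rightarrow> 'e set \<Rightarrow> ('e \<Rightarrow> 'a) \<Rightarrow> ('v, 'a + 'e) pre_digraph" where
  "augmented_digraph \<Delta> N r = \<lparr>
     verts = verts \<Delta>,
     arcs = arcs \<Delta> <+> N,
     tail = tail \<Delta> \<circ> rho r,
     head = head \<Delta> \<circ> rho r\<rparr>"

definition rho_fibre :: "('v, 'a) rgraph \<Rightarrow> 'e set \<Rightarrow> ('e \<Rightarrow> 'a) \<Rightarrow> 'a \<Rightarrow> ('a + 'e) set" where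
  "rho_fibre \<Delta> N r a = {b \<in> arcs (augmented_digraph \<Delta> N r). rho r b = a}"

text \<open>
  There may be infinitely many \<open>a\<close>-adhesion sets, so that \<open>i(a) - 1\<close> is a cardinal; it is the
  number of \<open>a\<close>-adhesion sets other than \<open>\<Phi>\<^sub>a(Y(a))\<close>.
\<close>

definition augmentation ::
  "('v, 'a, 'g, 'x, 'h, 'y) action_graph \<Rightarrow> 'e set \<Rightarrow> ('e \<Rightarrow> 'a) \<Rightarrow> bool" where
  "augmentation \<G> N r \<longleftrightarrow> r ` N \<subseteq> arcs (base \<G>) \<and>
     (\<forall>a \<in> arcs (base \<G>). {n \<in> N. r n = a} \<approx> adhesion_sets \<G> a - {emb \<G> a ` Y_of \<G> a})"

text \<open>
  \<open>\<pi>V\<close> and \<open>\<pi>A\<close> are the components of \<open>\<pi>\<^sub>+\<close>. The map \<open>\<beta>\<close> combines the bijections between the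
  (pairwise disjoint) fibres of \<open>\<rho>\<close> and the families of adhesion sets, and \<open>\<phi>\<close> provides the
  adhesion maps chosen for the new arcs.
\<close>

definition canonical_data ::
  "('v, 'a, 'g, 'x, 'h, 'y) action_graph \<Rightarrow> 'e set \<Rightarrow> ('e \<Rightarrow> 'a) \<Rightarrow> ('tv, 'ta) rgraph \<Rightarrow>
   ('tv \<Rightarrow> 'v) \<Rightarrow> ('ta \<Rightarrow> 'a + 'e) \<Rightarrow> ('a + 'e \<Rightarrow> 'x set) \<Rightarrow> ('e \<Rightarrow> 'y \<Rightarrow> 'x) \<Rightarrow> bool" where
  "canonical_data \<G> N r T \<pi>V \<pi>A \<beta> \<phi> \<longleftrightarrow>
     (let \<Delta> = base \<G>; D = augmented_digraph \<Delta> N r in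
      augmentation \<G> N r \<and>
      is_tree T \<and>
      digraph_morphism T D \<pi>V \<pi>A \<and> \<pi>V ` verts T = verts D \<and> \<pi>A ` arcs T = arcs D \<and>
      (\<forall>s \<in> verts T. bij_betw \<pi>A (in_arcs (digraph_of T) s) (in_arcs D (\<pi>V s))) \<and>
      graph_morphism T \<Delta> \<pi>V (rho r \<circ> \<pi>A) \<and>
      (\<forall>a \<in> arcs \<Delta>. bij_betw \<beta> (rho_fibre \<Delta> N r a) (adhesion_sets \<G> a) \<and>
         \<beta> (Inl a) = emb \<G> a ` Y_of \<G> a) \<and>
      (\<forall>n \<in> N. adhesion_map \<G> (r n) (\<phi> n) \<and> \<phi> n ` Y_of \<G> (r n) = \<beta> (Inr n)))"

definition emb_plus ::
  "('v, 'a, 'g, 'x, 'h, 'y) action_graph \<Rightarrow> ('e \<Rightarrow> 'y \<Rightarrow> 'x) \<Rightarrow> 'a + 'e \<Rightarrow> 'y \<Rightarrow> 'x" where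
  "emb_plus \<G> \<phi> = case_sum (emb \<G>) \<phi>"

definition canonical_graph ::
  "('v, 'a, 'g, 'x, 'h, 'y) action_graph \<Rightarrow> ('e \<Rightarrow> 'a) \<Rightarrow> ('tv, 'ta) rgraph \<Rightarrow>
   ('tv \<Rightarrow> 'v) \<Rightarrow> ('ta \<Rightarrow> 'a + 'e) \<Rightarrow> ('e \<Rightarrow> 'y \<Rightarrow> 'x) \<Rightarrow> ('tv \<times> 'x, 'ta \<times> 'y) rgraph" where
  "canonical_graph \<G> r T \<pi>V \<pi>A \<phi> = \<lparr>
     verts = (\<Union>v \<in> verts (base \<G>). {s \<in> verts T. \<pi>V s = v} \<times> X_of \<G> v),
     arcs = (\<Union>a \<in> arcs (base \<G>). {s \<in> arcs T. rho r (\<pi>A s) = a} \<times> Y_of \<G> a),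
     tail = (\<lambda>(s, y). (tail T s, emb_plus \<G> \<phi> (\<pi>A (arev T s)) y)),
     head = (\<lambda>(s, y). (head T s, emb_plus \<G> \<phi> (\<pi>A s) y)),
     arev = (\<lambda>(s, y). (arev T s, y))\<rparr>"

definition same_index :: "('s \<times> 'z) set \<Rightarrow> ('s \<times> 'z) rel" where
  "same_index W = {(w, w'). w \<in> W \<and> w' \<in> W \<and> fst w = fst w'}"

text \<open>
  The identification of the quotient with \<open>T\<close>: a class is sent to the common first coordinate
  of its elements.
\<close>

definition class_index :: "('s \<times> 'z) set \<Rightarrow> 's" where
  "class_index C = the_elem (fst ` C)"

end

theory Submission
  imports Defs
begin

text \<open>
  The classes of \<open>\<Sigma>\<close> are the sets \<open>{s} \<times> X(\<pi>(s))\<close> and \<open>{s} \<times> Y(\<pi>(s))\<close>, so that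
  \<open>s \<mapsto> {s} \<times> \<dots>\<close> is an isomorphism from \<open>T\<close> onto \<open>\<Sigma>/\<sim>\<close>, and \<open>\<Psi>\<close> is \<open>\<Phi>\<^bsub>\<pi>\<^sub>+(s)\<^esub>\<close> on the class of the
  arc \<open>s\<close>. The arcs of \<open>T\<close> ending in a vertex \<open>s\<close> and lying over \<open>b\<close> correspond, via \<open>\<pi>\<^sub>+\<close>, to the
  elements of \<open>\<rho>\<^sup>-\<^sup>1(b)\<close>, and these correspond to the \<open>b\<close>-adhesion sets.
\<close>

section \<open>Basic facts on graphs and trees\<close>

lemma digraph_of_simps [simp]:
  "verts (digraph_of \<Gamma>) = verts \<Gamma>" "arcs (digraph_of \<Gamma>) = arcs \<Gamma>"
  "tail (digraph_of \<Gamma>) = tail \<Gamma>" "head (digraph_of \<Gamma>) = head \<Gamma>"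
  by (simp_all add: pre_digraph.defs)

lemma is_graphD:
  assumes "is_graph \<Gamma>" "a \<in> arcs \<Gamma>"
  shows "tail \<Gamma> a \<in> verts \<Gamma>" "head \<Gamma> a \<in> verts \<Gamma>" "arev \<Gamma> a \<in> arcs \<Gamma>"
    "arev \<Gamma> (arev \<Gamma> a) = a" "tail \<Gamma> (arev \<Gamma> a) = head \<Gamma> a" "head \<Gamma> (arev \<Gamma> a) = tail \<Gamma> a"
  using assms unfolding is_graph_def wf_digraph_def by auto

text \<open>An origin is the terminus of the reverse arc, so the conditions on termini and reversal
  already place origins among the vertices.\<close>

lemma is_graphI:
  assumes "\<And>a. a \<in> arcs \<Gamma> \<Longrightarrow> head \<Gamma> a \<in> verts \<Gamma>"
    and "\<And>a. a \<in> arcs \<Gamma> \<Longrightarrow> arev \<Gamma> a \<in> arcs \<Gamma>"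
    and "\<And>a. a \<in> arcs \<Gamma> \<Longrightarrow> arev \<Gamma> (arev \<Gamma> a) = a"
    and "\<And>a. a \<in> arcs \<Gamma> \<Longrightarrow> tail \<Gamma> a = head \<Gamma> (arev \<Gamma> a)"
  shows "is_graph \<Gamma>"
  using assms unfolding is_graph_def wf_digraph_def by simp

lemma is_tree_no_loop: "is_tree \<Gamma> \<Longrightarrow> a \<in> arcs \<Gamma> \<Longrightarrow> tail \<Gamma> a \<noteq> head \<Gamma> a"
  unfolding is_tree_def using loopfree_digraph.no_loops by fastforce

lemma is_tree_no_multi:
  "is_tree \<Gamma> \<Longrightarrow> a \<in> arcs \<Gamma> \<Longrightarrow> b \<in> arcs \<Gamma> \<Longrightarrow> tail \<Gamma> a = tail \<Gamma> b \<Longrightarrow> head \<Gamma> a = head \<Gamma> b \<Longrightarrow> a = b"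
  unfolding is_tree_def using nomulti_digraph.no_multi_arcs
  by (fastforce simp: arc_to_ends_def)

section \<open>Isomorphic images of trees\<close>

text \<open>Connectedness is reachability in the symmetric closure. A morphism carries walks there
  to walks, whichever way each arc is traversed, and surjectivity on vertices then covers every pair
  in \<Delta>.\<close>

lemma connected_morphism_image:
  assumes "connected \<Gamma>" "digraph_morphism \<Gamma> \<Delta> fV fA" "verts \<Delta> = fV ` verts \<Gamma>"
  shows "connected \<Delta>"
proof -
  have "fV u \<rightarrow>\<^sup>*\<^bsub>mk_symmetric \<Delta>\<^esub> fV v" if "u \<rightarrow>\<^sup>*\<^bsub>mk_symmetric \<Gamma>\<^esub> v" for u v
    using that unfolding reachable_def
  proof (induction rule: rtrancl_on_induct)
    case base
    then show ?case using assms(3) by simp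
  next
    case (step y z)
    then obtain e where e: "e \<in> arcs \<Gamma>" "(y, z) = (tail \<Gamma> e, head \<Gamma> e) \<or> (y, z) = (head \<Gamma> e, tail \<Gamma> e)"
      by (auto simp: parcs_mk_symmetric)
    \<comment> \<open>The arc \<open>fA e\<close> is traversed in the same direction as
      \<open>e\<close>.\<close>
    then have "(fV y, fV z) \<in> parcs (mk_symmetric \<Delta>)"
      using assms(2) unfolding digraph_morphism_def parcs_mk_symmetric
      by (intro UN_I[where a = "fA e"]) auto
    then show ?case
      using step assms(3) by (auto intro: rtrancl_on_into_rtrancl_on)
  qed
  then show ?thesis
    using assms(1,3) unfolding connected_def strongly_connected_def by auto
qed

lemma cas_morphism:
  assumes "digraph_morphism \<Gamma> \<Delta> fV fA" "set p \<subseteq> arcs \<Gamma>" "pre_digraph.cas \<Gamma> u p v"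
  shows "pre_digraph.cas \<Delta> (fV u) (map fA p) (fV v)"
  using assms(2,3)
  by (induction p arbitrary: u)
    (use assms(1) in \<open>auto simp: pre_digraph.cas.simps digraph_morphism_def\<close>)

text \<open>A morphism preserves closed walks; injectivity on vertices is what keeps the visited
  vertices distinct.\<close>

lemma cycle_morphism:
  assumes f: "digraph_morphism \<Gamma> \<Delta> fV fA" and "wf_digraph \<Gamma>" "inj_on fV (verts \<Gamma>)"
    and "pre_digraph.cycle \<Gamma> c"
  shows "pre_digraph.cycle \<Delta> (map fA c)"
proof -
  obtain u where u: "u \<in> verts \<Gamma>" "set c \<subseteq> arcs \<Gamma>" "pre_digraph.cas \<Gamma> u c u"
    "distinct (tl (pre_digraph.awalk_verts \<Gamma> u c))" "c \<noteq> []"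
    using assms(4) unfolding pre_digraph.cycle_def pre_digraph.awalk_def by auto
  \<comment> \<open>Since \<open>c\<close> is non-empty, its vertex list is the list of origins
    followed by the terminus of the last arc, and both commute with the morphism.\<close>
  have "pre_digraph.awalk_verts \<Delta> (fV u) (map fA c) = map fV (pre_digraph.awalk_verts \<Gamma> u c)"
    using f u(2) last_in_set[OF u(5)]
    by (auto simp: pre_digraph.awalk_verts_conv digraph_morphism_def u(5) last_map subset_iff)
  moreover have "set (tl (pre_digraph.awalk_verts \<Gamma> u c)) \<subseteq> verts \<Gamma>"
  proof -
    have "set (pre_digraph.awalk_verts \<Gamma> u c) \<subseteq> verts \<Gamma>"
      using u(2,5) assms(2) last_in_set[OF u(5)]
      by (auto simp: pre_digraph.awalk_verts_conv wf_digraph_def subset_iff)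
    then show ?thesis
      by (metis list.set_sel(2) subset_iff tl_Nil)
  qed
  ultimately have "distinct (tl (pre_digraph.awalk_verts \<Delta> (fV u) (map fA c)))"
    using u(4) assms(3) by (simp add: map_tl[symmetric] distinct_map inj_on_subset)
  moreover have "fV u \<in> verts \<Delta>" "set (map fA c) \<subseteq> arcs \<Delta>"
    using f u(1,2) unfolding digraph_morphism_def by auto
  ultimately show ?thesis
    using u(5) cas_morphism[OF f u(2,3)] unfolding pre_digraph.cycle_def pre_digraph.awalk_def by auto
qed

text \<open>By well-formedness the ends of arcs are vertices, where \<open>inv_into\<close> cancels
  \<open>fV\<close>.\<close>

lemma digraph_morphism_inv:
  assumes "digraph_morphism \<Gamma> \<Delta> fV fA" "bij_betw fV (verts \<Gamma>) (verts \<Delta>)"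
    "bij_betw fA (arcs \<Gamma>) (arcs \<Delta>)" "wf_digraph \<Gamma>"
  shows "digraph_morphism \<Delta> \<Gamma> (inv_into (verts \<Gamma>) fV) (inv_into (arcs \<Gamma>) fA)"
proof -
  have "verts \<Delta> = fV ` verts \<Gamma>" "arcs \<Delta> = fA ` arcs \<Gamma>"
    "inj_on fV (verts \<Gamma>)" "inj_on fA (arcs \<Gamma>)"
    using assms(2,3) by (auto simp: bij_betw_def)
  then show ?thesis
    using assms(1,4) by (auto simp: digraph_morphism_def wf_digraph_def)
qed

text \<open>All properties but acyclicity are pushed forward along the isomorphism. A cycle in
  \<Delta> is instead pulled back along the inverse morphism, which keeps its length.\<close>

lemma is_tree_iso:
  assumes tree: "is_tree \<Gamma>" and f: "graph_morphism \<Gamma> \<Delta> fV fA"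
    and bV: "bij_betw fV (verts \<Gamma>) (verts \<Delta>)" and bA: "bij_betw fA (arcs \<Gamma>) (arcs \<Delta>)"
  shows "is_tree \<Delta>"
proof -
  note graph = tree[unfolded is_tree_def, THEN conjunct1]
  note g = is_graphD[OF graph]
  have vD: "verts \<Delta> = fV ` verts \<Gamma>" and aD: "arcs \<Delta> = fA ` arcs \<Gamma>"
    using bV bA by (auto simp: bij_betw_def)
  have mor: "digraph_morphism (digraph_of \<Gamma>) (digraph_of \<Delta>) fV fA"
    using f by (simp add: graph_morphism_def digraph_morphism_def)
  have ends: "tail \<Delta> (fA a) = fV (tail \<Gamma> a)" "head \<Delta> (fA a) = fV (head \<Gamma> a)"
    "arev \<Delta> (fA a) = fA (arev \<Gamma> a)" if "a \<in> arcs \<Gamma>" for a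
    using f that by (auto simp: graph_morphism_def digraph_morphism_def)
  have injV: "fV u = fV v \<longleftrightarrow> u = v" if "u \<in> verts \<Gamma>" "v \<in> verts \<Gamma>" for u v
    using bV that by (auto simp: bij_betw_def inj_on_def)
  have graph': "is_graph \<Delta>"
    by (rule is_graphI) (auto simp: aD vD ends g)
  have wf: "wf_digraph (digraph_of \<Gamma>)" "wf_digraph (digraph_of \<Delta>)"
    using graph graph' by (simp_all add: is_graph_def)
  have conn: "connected (digraph_of \<Delta>)"
    using tree connected_morphism_image[OF _ mor] by (simp add: is_tree_def vD)
  have loopfree: "loopfree_digraph (digraph_of \<Delta>)"
    by (intro loopfree_digraph.intro wf loopfree_digraph_axioms.intro)
      (use is_tree_no_loop[OF tree] in \<open>auto simp: aD ends injV g\<close>)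
  have nomulti: "nomulti_digraph (digraph_of \<Delta>)"
    by (intro nomulti_digraph.intro wf nomulti_digraph_axioms.intro)
      (auto simp: aD ends injV g arc_to_ends_def intro!: arg_cong[where f = fA] is_tree_no_multi[OF tree])
  have "length c < 3" if c: "pre_digraph.cycle (digraph_of \<Delta>) c" for c
  proof -
    have "pre_digraph.cycle (digraph_of \<Gamma>) (map (inv_into (arcs \<Gamma>) fA) c)"
      using cycle_morphism[OF digraph_morphism_inv[OF mor] wf(2) _ c] bV bA wf(1)
      by (simp add: bij_betw_def inj_on_inv_into)
    then show ?thesis
      using tree by (force simp: is_tree_def)
  qed
  then show ?thesis
    using graph' conn loopfree nomulti unfolding is_tree_def by (meson not_less)
qed

section \<open>Classes of pairs with the same first coordinate\<close>

lemma equiv_same_index: "equiv W (same_index W)"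
  by (rule equivI) (auto simp: same_index_def refl_on_def sym_def trans_def)

text \<open>Stated for any non-empty part \<open>C\<close> of a fibre: a singleton gives the class
  of one element, and the set of ends of an arc class may be a proper part of a vertex
  class.\<close>

lemma same_index_Image_Sigma:
  assumes "C \<noteq> {}" "C \<subseteq> {s} \<times> B s" "s \<in> A"
  shows "same_index (Sigma A B) `` C = {s} \<times> B s"
proof -
  obtain z where "(s, z) \<in> C"
    using assms(1,2) by auto
  then show ?thesis
    using assms(2,3) unfolding same_index_def by force
qed

text \<open>Non-emptiness of the fibres matters: an index with empty fibre would put the empty set
  on the right, which is never a class.\<close>

lemma quotient_same_index_Sigma:
  assumes "\<And>s. s \<in> A \<Longrightarrow> B s \<noteq> {}"
  shows "Sigma A B // same_index (Sigma A B) = (\<lambda>s. {s} \<times> B s) ` A"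
proof -
  have "Sigma A B // same_index (Sigma A B)
      = (\<lambda>w. same_index (Sigma A B) `` {w}) ` Sigma A B"
    by (auto simp: quotient_def)
  also have "\<dots> = (\<lambda>w. {fst w} \<times> B (fst w)) ` Sigma A B"
    by (rule image_cong) (auto simp: same_index_def)
  also have "\<dots> = (\<lambda>s. {s} \<times> B s) ` fst ` Sigma A B"
    by (simp add: image_image)
  also have "fst ` Sigma A B = A"
    using assms by force
  finally show ?thesis .
qed

lemma class_index_Times [simp]: "Z \<noteq> {} \<Longrightarrow> class_index ({s} \<times> Z) = s"
  by (simp add: class_index_def fst_image_times)

lemma bij_betw_snd_Times: "bij_betw snd ({s} \<times> Z) Z"
  by (auto simp: bij_betw_def inj_on_def)

section \<open>Adhesion maps\<close>

text \<open>Take the group element to be the identity. It acts as the identity map restricted to the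
  points, hence the check that \<open>emb\<close> takes values there.\<close>

lemma adhesion_map_emb:
  assumes "graph_of_group_actions \<G>" "a \<in> arcs (base \<G>)"
  shows "adhesion_map \<G> a (emb \<G> a)"
proof -
  let ?P = "vact \<G> (head (base \<G>) a)"
  have "is_graph (base \<G>)"
    using assms(1) by (simp add: graph_of_group_actions_def)
  then have "perm_group_action ?P"
    using assms is_graphD(2) by (fastforce simp: graph_of_group_actions_def)
  then interpret group_action "grp ?P" "pts ?P" "act ?P"
    by (simp add: perm_group_action_def faithful_action_def)
  have "emb \<G> a ` Y_of \<G> a \<subseteq> pts ?P"
    using assms by (auto simp: graph_of_group_actions_def embedding_def)
  then have "\<forall>y \<in> Y_of \<G> a. emb \<G> a y = act ?P \<one>\<^bsub>grp ?P\<^esub> (emb \<G> a y)"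
    using id_eq_one by (metis image_subset_iff restrict_apply')
  moreover have "\<one>\<^bsub>grp ?P\<^esub> \<in> carrier (grp ?P)"
    using group_hom group_hom.axioms(1) group.is_monoid monoid.one_closed by blast
  ultimately show ?thesis
    unfolding adhesion_map_def by blast
qed

lemma adhesion_map_in_pts:
  assumes "graph_of_group_actions \<G>" "a \<in> arcs (base \<G>)" "adhesion_map \<G> a f" "y \<in> Y_of \<G> a"
  shows "f y \<in> X_of \<G> (head (base \<G>) a)"
proof -
  let ?P = "vact \<G> (head (base \<G>) a)"
  have "is_graph (base \<G>)"
    using assms(1) by (simp add: graph_of_group_actions_def)
  then have "perm_group_action ?P"
    using assms(1,2) is_graphD(2) by (fastforce simp: graph_of_group_actions_def)
  then interpret group_action "grp ?P" "pts ?P" "act ?P"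
    by (simp add: perm_group_action_def faithful_action_def)
  have "emb \<G> a y \<in> pts ?P"
    using assms(1,2,4) by (auto simp: graph_of_group_actions_def embedding_def image_subset_iff)
  moreover obtain g where "g \<in> carrier (grp ?P)" "f y = act ?P g (emb \<G> a y)"
    using assms(3,4) unfolding adhesion_map_def by blast
  ultimately show ?thesis
    using element_image by simp
qed

lemma adhesion_map_cong:
  "adhesion_map \<G> a f \<Longrightarrow> (\<And>y. y \<in> Y_of \<G> a \<Longrightarrow> f' y = f y) \<Longrightarrow> adhesion_map \<G> a f'"
  unfolding adhesion_map_def by auto

section \<open>The canonical graph\<close>

locale canonical_construction =
  fixes \<G> :: "('v, 'a, 'g, 'x, 'h, 'y) action_graph"
    and N :: "'e set" and r :: "'e \<Rightarrow> 'a"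
    and T :: "('tv, 'ta) rgraph"
    and \<pi>V :: "'tv \<Rightarrow> 'v" and \<pi>A :: "'ta \<Rightarrow> 'a + 'e"
    and \<beta> :: "'a + 'e \<Rightarrow> 'x set" and \<phi> :: "'e \<Rightarrow> 'y \<Rightarrow> 'x"
  assumes gga: "graph_of_group_actions \<G>"
    and data: "canonical_data \<G> N r T \<pi>V \<pi>A \<beta> \<phi>"
begin

abbreviation "\<Delta> \<equiv> base \<G>"
abbreviation "D \<equiv> augmented_digraph \<Delta> N r"
abbreviation "\<pi> s \<equiv> rho r (\<pi>A s)"
abbreviation "X s \<equiv> X_of \<G> (\<pi>V s)"
abbreviation "Y s \<equiv> Y_of \<G> (\<pi> s)"
abbreviation "\<Phi> s \<equiv> emb_plus \<G> \<phi> (\<pi>A s)"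
abbreviation "\<Sigma>' \<equiv> canonical_graph \<G> r T \<pi>V \<pi>A \<phi>"
abbreviation "R \<equiv> same_index (verts \<Sigma>')"
abbreviation "S \<equiv> same_index (arcs \<Sigma>')"
abbreviation "Q \<equiv> quotient_graph \<Sigma>' R S"
abbreviation "vclass s \<equiv> {s} \<times> X s"
abbreviation "aclass s \<equiv> {s} \<times> Y s"

section \<open>Consequences of the data of the construction\<close>

lemma base_graph: "is_graph \<Delta>"
  using gga by (simp add: graph_of_group_actions_def)

lemma T_tree: "is_tree T"
  using data by (simp add: canonical_data_def Let_def)

lemma T_graph: "is_graph T"
  using T_tree by (simp add: is_tree_def)

lemmas T_simps = is_graphD[OF T_graph]

lemma \<pi>_morphism: "graph_morphism T \<Delta> \<pi>V (rho r \<circ> \<pi>A)"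
  using data by (simp add: canonical_data_def Let_def)

lemma \<pi>V_in: "s \<in> verts T \<Longrightarrow> \<pi>V s \<in> verts \<Delta>"
  using \<pi>_morphism by (auto simp: graph_morphism_def digraph_morphism_def)

lemma \<pi>_simps:
  assumes "s \<in> arcs T"
  shows "\<pi> s \<in> arcs \<Delta>" "tail \<Delta> (\<pi> s) = \<pi>V (tail T s)" "head \<Delta> (\<pi> s) = \<pi>V (head T s)"
    "\<pi> (arev T s) = arev \<Delta> (\<pi> s)"
  using \<pi>_morphism assms by (auto simp: graph_morphism_def digraph_morphism_def)

lemma \<pi>A_in: "s \<in> arcs T \<Longrightarrow> \<pi>A s \<in> arcs D"
  using data by (auto simp: canonical_data_def Let_def digraph_morphism_def)

lemma X_nonempty: "s \<in> verts T \<Longrightarrow> X s \<noteq> {}"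
  using gga \<pi>V_in by (auto simp: graph_of_group_actions_def perm_group_action_def)

lemma Y_nonempty: "s \<in> arcs T \<Longrightarrow> Y s \<noteq> {}"
  using gga \<pi>_simps(1) by (auto simp: graph_of_group_actions_def perm_group_action_def)

lemma Y_arev: "s \<in> arcs T \<Longrightarrow> Y (arev T s) = Y s"
  using gga \<pi>_simps by (simp add: graph_of_group_actions_def)

text \<open>Each vertex of \<open>T\<close> lies over exactly one vertex of the base graph, so the
  union over the base regroups as a dependent sum over \<open>T\<close>, the form used by the lemmas
  on classes.\<close>

lemma verts_canonical: "verts \<Sigma>' = Sigma (verts T) X"
  using \<pi>V_in by (auto simp: canonical_graph_def)

lemma arcs_canonical: "arcs \<Sigma>' = Sigma (arcs T) Y"
  using \<pi>_simps(1) by (auto simp: canonical_graph_def)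

lemma canonical_simps [simp]:
  "tail \<Sigma>' (s, y) = (tail T s, \<Phi> (arev T s) y)"
  "head \<Sigma>' (s, y) = (head T s, \<Phi> s y)"
  "arev \<Sigma>' (s, y) = (arev T s, y)"
  by (simp_all add: canonical_graph_def)

section \<open>The adhesion maps attached to the arcs of \<open>T\<close>\<close>

lemma \<Phi>_adhesion_map:
  assumes "s \<in> arcs T"
  shows "adhesion_map \<G> (\<pi> s) (\<Phi> s)"
proof (cases "\<pi>A s")
  case (Inl a)
  then show ?thesis
    using adhesion_map_emb[OF gga] \<pi>_simps(1)[OF assms] by (simp add: emb_plus_def rho_def)
next
  case (Inr n)
  \<comment> \<open>\<phi> is prescribed only on \<open>N\<close>; the index lies there because
    \<open>\<pi>A s\<close> is an arc of the augmented digraph.\<close>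
  then have "n \<in> N"
    using \<pi>A_in[OF assms] by (auto simp: augmented_digraph_def)
  then show ?thesis
    using Inr data by (simp add: emb_plus_def rho_def canonical_data_def Let_def)
qed

lemma \<Phi>_image:
  assumes "s \<in> arcs T"
  shows "\<Phi> s ` Y s = \<beta> (\<pi>A s)"
proof (cases "\<pi>A s")
  case (Inl a)
  then show ?thesis
    using data \<pi>_simps(1)[OF assms] by (simp add: emb_plus_def rho_def canonical_data_def Let_def)
next
  case (Inr n)
  then have "n \<in> N"
    using \<pi>A_in[OF assms] by (auto simp: augmented_digraph_def)
  then show ?thesis
    using Inr data by (simp add: emb_plus_def rho_def canonical_data_def Let_def)
qed

lemma \<Phi>_in_X: "s \<in> arcs T \<Longrightarrow> y \<in> Y s \<Longrightarrow> \<Phi> s y \<in> X (head T s)"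
  using adhesion_map_in_pts[OF gga _ \<Phi>_adhesion_map] \<pi>_simps by metis

text \<open>Origins are termini of reverse arcs, and an arc and its reverse have the same
  fibre.\<close>

lemma \<Phi>_arev_in_X: "s \<in> arcs T \<Longrightarrow> y \<in> Y s \<Longrightarrow> \<Phi> (arev T s) y \<in> X (tail T s)"
  using \<Phi>_in_X[of "arev T s"] by (simp add: T_simps Y_arev)

lemma canonical_is_graph: "is_graph \<Sigma>'"
  by (rule is_graphI) (auto simp: verts_canonical arcs_canonical T_simps \<Phi>_in_X Y_arev)

section \<open>The quotient graph and its identification with \<open>T\<close>\<close>

lemma verts_quotient: "verts Q = vclass ` verts T"
  unfolding quotient_graph_def
  using quotient_same_index_Sigma[of "verts T" X] X_nonempty by (simp add: verts_canonical)

lemma arcs_quotient: "arcs Q = aclass ` arcs T"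
  unfolding quotient_graph_def
  using quotient_same_index_Sigma[of "arcs T" Y] Y_nonempty by (simp add: arcs_canonical)

text \<open>The ends of the arcs in a class form a non-empty part of one vertex class, which the
  image under \<open>R\<close> completes to the whole class.\<close>

lemma quotient_simps:
  assumes "s \<in> arcs T"
  shows "tail Q (aclass s) = vclass (tail T s)"
    "head Q (aclass s) = vclass (head T s)"
    "arev Q (aclass s) = aclass (arev T s)"
  unfolding quotient_graph_def verts_canonical arcs_canonical pre_digraph.simps rgraph.simps
  by (rule same_index_Image_Sigma;
    use assms Y_nonempty in \<open>auto simp: T_simps \<Phi>_in_X \<Phi>_arev_in_X Y_arev\<close>)+

lemma class_isomorphism:
  "graph_morphism T Q vclass aclass"
  "bij_betw vclass (verts T) (verts Q)" "bij_betw aclass (arcs T) (arcs Q)"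
proof -
  show "graph_morphism T Q vclass aclass"
    by (simp add: graph_morphism_def digraph_morphism_def verts_quotient arcs_quotient quotient_simps)
  show "bij_betw vclass (verts T) (verts Q)"
    by (rule bij_betwI'[where Y = "verts Q"]) (use X_nonempty in \<open>auto simp: verts_quotient\<close>)
  show "bij_betw aclass (arcs T) (arcs Q)"
    by (rule bij_betwI'[where Y = "arcs Q"]) (use Y_nonempty in \<open>auto simp: arcs_quotient\<close>)
qed

lemma quotient_tree: "is_tree Q"
  by (rule is_tree_iso[OF T_tree class_isomorphism])

lemma vclass_eq_iff: "s \<in> verts T \<Longrightarrow> vclass s = vclass s' \<longleftrightarrow> s = s'"
  using X_nonempty by auto

lemma quotient_morphism:
  "graph_morphism Q \<Delta> (\<pi>V \<circ> class_index) (rho r \<circ> \<pi>A \<circ> class_index)"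
proof -
  \<comment> \<open>The fibre of a reversed arc appears in this form after rewriting with
    \<open>\<pi>_simps\<close>; evaluating \<open>class_index\<close> on its class requires it to be
    non-empty.\<close>
  have "Y_of \<G> (arev \<Delta> (\<pi> s)) \<noteq> {}" if "s \<in> arcs T" for s
    using Y_nonempty[of "arev T s"] that by (simp add: \<pi>_simps T_simps)
  then show ?thesis
    unfolding graph_morphism_def digraph_morphism_def
    by (auto simp: verts_quotient arcs_quotient quotient_simps X_nonempty Y_nonempty \<pi>V_in \<pi>_simps
        T_simps)
qed

text \<open>The construction compares arcs by first coordinate, a scaffolding by their ends. Arcs
  with equivalent ends lie over arcs of \<open>T\<close> with equal ends, and these coincide as
  \<open>T\<close> has no multiple arcs.\<close>

lemma arc_extension_canonical: "S = arc_extension \<Sigma>' R"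
proof -
  have "(a, b) \<in> S \<longleftrightarrow> (a, b) \<in> arc_extension \<Sigma>' R" for a b
  proof (cases a; cases b)
    fix s y s' y'
    assume "a = (s, y)" "b = (s', y')"
    then show ?thesis
      using is_tree_no_multi[OF T_tree, of s s']
      by (auto simp: arc_extension_def same_index_def arcs_canonical verts_canonical T_simps
          \<Phi>_in_X \<Phi>_arev_in_X)
  qed
  then show ?thesis by auto
qed

lemma vertex_class:
  assumes "v \<in> verts \<Sigma>'"
  obtains s where "s \<in> verts T" "R `` {v} = vclass s"
proof
  show "fst v \<in> verts T"
    using assms by (auto simp: verts_canonical)
  show "R `` {v} = vclass (fst v)"
    using assms unfolding verts_canonical by (intro same_index_Image_Sigma) auto
qed

lemma arc_class:
  assumes "a \<in> arcs \<Sigma>'"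
  obtains s where "s \<in> arcs T" "S `` {a} = aclass s"
proof
  show "fst a \<in> arcs T"
    using assms by (auto simp: arcs_canonical)
  show "S `` {a} = aclass (fst a)"
    using assms unfolding arcs_canonical by (intro same_index_Image_Sigma) auto
qed

section \<open>The maps \<Psi> and the arcs realising an adhesion set\<close>

lemma class_map_canonical:
  "class_map \<Sigma>' snd snd (Y s) (aclass s) = restrict (\<Phi> s) (Y s)"
  unfolding class_map_def
  \<comment> \<open>The arc \<open>(s, y)\<close> forces the value at each \<open>y\<close> in
    \<open>Y s\<close>; extensionality fixes all other values.\<close>
  by (rule the_equality) (auto intro!: extensionalityI[of _ "Y s"])

lemma ex1_arc:
  assumes s: "s \<in> verts T" and b: "b \<in> arcs \<Delta>" "head \<Delta> b = \<pi>V s"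
    and Z: "Z \<in> adhesion_sets \<G> b"
  shows "\<exists>!a. a \<in> arcs T \<and> head T a = s \<and> \<pi> a = b \<and> \<Phi> a ` Y a = Z"
proof -
  have star: "bij_betw \<pi>A (in_arcs (digraph_of T) s) (in_arcs D (\<pi>V s))"
    and \<beta>: "bij_betw \<beta> (rho_fibre \<Delta> N r b) (adhesion_sets \<G> b)"
    using data s b(1) by (simp_all add: canonical_data_def Let_def)
  from Z have "Z \<in> \<beta> ` rho_fibre \<Delta> N r b"
    using bij_betw_imp_surj_on[OF \<beta>] by simp
  then obtain c where c: "c \<in> arcs D" "rho r c = b" "\<beta> c = Z"
    by (auto simp: rho_fibre_def)
  \<comment> \<open>Arcs of \<open>D\<close> have the ends of their images under \<open>rho\<close>,
    so \<open>c\<close> ends where \<open>b\<close> does and lifts to an arc of \<open>T\<close>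
    ending in \<open>s\<close>.\<close>
  then have "c \<in> in_arcs D (\<pi>V s)"
    using b(2) by (simp add: in_arcs_def augmented_digraph_def)
  then have "c \<in> \<pi>A ` in_arcs (digraph_of T) s"
    using bij_betw_imp_surj_on[OF star] by simp
  then obtain a where a: "a \<in> arcs T" "head T a = s" "\<pi>A a = c"
    by (auto simp: in_arcs_def)
  show ?thesis
  proof (rule ex1I[of _ a])
    show "a \<in> arcs T \<and> head T a = s \<and> \<pi> a = b \<and> \<Phi> a ` Y a = Z"
      using a c \<Phi>_image[OF a(1)] by simp
  next
    fix a'
    assume a': "a' \<in> arcs T \<and> head T a' = s \<and> \<pi> a' = b \<and> \<Phi> a' ` Y a' = Z"
    \<comment> \<open>\<beta> is injective only within one fibre of \<open>rho\<close>, so both arcs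
      must first be placed over \<open>b\<close>. Injectivity of \<open>\<pi>A\<close> on the star
      of \<open>s\<close> then finishes.\<close>
    then have "\<pi>A a' \<in> rho_fibre \<Delta> N r b" "c \<in> rho_fibre \<Delta> N r b" "\<beta> (\<pi>A a') = \<beta> c"
      using c \<pi>A_in \<Phi>_image[of a'] by (auto simp: rho_fibre_def)
    then have "\<pi>A a' = \<pi>A a"
      using \<beta> a(3) by (auto simp: bij_betw_def inj_on_def)
    then show "a' = a"
      using star a a' by (auto simp: bij_betw_def inj_on_def in_arcs_def)
  qed
qed

text \<open>Transport of \<open>ex1_arc\<close> along \<open>aclass\<close>, whose values exhaust
  the arcs of \<open>Q\<close>.\<close>

lemma ex1_arc_class:
  assumes s: "s \<in> verts T" and b: "b \<in> arcs \<Delta>" "head \<Delta> b = \<pi>V s"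
    and Z: "Z \<in> adhesion_sets \<G> b"
  shows "\<exists>!A. A \<in> arcs Q \<and> head Q A = vclass s \<and> \<pi> (class_index A) = b
    \<and> class_map \<Sigma>' snd snd (Y (class_index A)) A ` Y_of \<G> b = Z"
proof -
  \<comment> \<open>The condition \<open>\<pi> a = b\<close> makes the set on which the image is
    taken equal to \<open>Y a\<close>, where the class map agrees with
    \<open>\<Phi> a\<close>.\<close>
  have iff: "aclass a \<in> arcs Q \<and> head Q (aclass a) = vclass s \<and> \<pi> (class_index (aclass a)) = b
      \<and> class_map \<Sigma>' snd snd (Y (class_index (aclass a))) (aclass a) ` Y_of \<G> b = Z
    \<longleftrightarrow> head T a = s \<and> \<pi> a = b \<and> \<Phi> a ` Y a = Z" if "a \<in> arcs T" for a
    using that vclass_eq_iff[OF s, of "head T a"]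
    by (auto simp: quotient_simps arcs_quotient Y_nonempty class_map_canonical)
  obtain a where a: "a \<in> arcs T" "head T a = s" "\<pi> a = b" "\<Phi> a ` Y a = Z"
    and unique: "\<And>a'. a' \<in> arcs T \<Longrightarrow> head T a' = s \<Longrightarrow> \<pi> a' = b \<Longrightarrow> \<Phi> a' ` Y a' = Z \<Longrightarrow> a' = a"
    using ex1_arc[OF assms] by metis
  show ?thesis
  proof (rule ex1I[of _ "aclass a"])
    show "aclass a \<in> arcs Q \<and> head Q (aclass a) = vclass s \<and> \<pi> (class_index (aclass a)) = b
      \<and> class_map \<Sigma>' snd snd (Y (class_index (aclass a))) (aclass a) ` Y_of \<G> b = Z"
      using iff[OF a(1)] a(2-4) by blast
  next
    fix A
    assume A: "A \<in> arcs Q \<and> head Q A = vclass s \<and> \<pi> (class_index A) = b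
      \<and> class_map \<Sigma>' snd snd (Y (class_index A)) A ` Y_of \<G> b = Z"
    then obtain a' where "a' \<in> arcs T" "A = aclass a'"
      by (auto simp: arcs_quotient)
    then show "A = aclass a"
      using A iff[of a'] unique[of a'] by blast
  qed
qed

lemma canonical_scaffolding:
  "scaffolding \<G> \<Sigma>' R S (\<pi>V \<circ> class_index) (rho r \<circ> \<pi>A \<circ> class_index) snd snd"
  unfolding scaffolding_def Let_def
proof (intro conjI)
  show "is_graph \<Sigma>'" by (rule canonical_is_graph)
  show "equiv (verts \<Sigma>') R" by (rule equiv_same_index)
  show "S = arc_extension \<Sigma>' R" by (rule arc_extension_canonical)
  show "is_tree Q" by (rule quotient_tree)
  show "\<forall>a \<in> arcs \<Sigma>'. (tail \<Sigma>' a, head \<Sigma>' a) \<notin> R"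
    \<comment> \<open>An arc with equivalent ends would lie over a loop of \<open>T\<close>.\<close>
    using is_tree_no_loop[OF T_tree] by (auto simp: arcs_canonical same_index_def)
  show "graph_morphism Q \<Delta> (\<pi>V \<circ> class_index) (rho r \<circ> \<pi>A \<circ> class_index)"
    by (rule quotient_morphism)
  show "\<forall>v \<in> verts \<Sigma>'. bij_betw snd (R `` {v}) (X_of \<G> ((\<pi>V \<circ> class_index) (R `` {v})))"
    by (auto simp: X_nonempty bij_betw_snd_Times elim!: vertex_class)
  show "\<forall>a \<in> arcs \<Sigma>'. bij_betw snd (S `` {a}) (Y_of \<G> ((rho r \<circ> \<pi>A \<circ> class_index) (S `` {a})))"
    by (auto simp: Y_nonempty bij_betw_snd_Times elim!: arc_class)
  show "\<forall>b \<in> arcs \<Sigma>'. snd (arev \<Sigma>' b) = snd b"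
    by (auto simp: arcs_canonical)
  show "\<forall>A \<in> arcs Q. adhesion_map \<G> ((rho r \<circ> \<pi>A \<circ> class_index) A)
      (class_map \<Sigma>' snd snd (Y_of \<G> ((rho r \<circ> \<pi>A \<circ> class_index) A)) A)"
    \<comment> \<open>The class map equals \<open>\<Phi> s\<close> only on \<open>Y s\<close>, which
      is all that being an adhesion map depends on.\<close>
    by (auto simp: arcs_quotient Y_nonempty class_map_canonical
        intro: adhesion_map_cong[OF \<Phi>_adhesion_map])
  show "\<forall>V \<in> verts Q. \<forall>b \<in> arcs \<Delta>. head \<Delta> b = (\<pi>V \<circ> class_index) V \<longrightarrow>
      (\<forall>Z \<in> adhesion_sets \<G> b.
        \<exists>!A. A \<in> arcs Q \<and> head Q A = V \<and> (rho r \<circ> \<pi>A \<circ> class_index) A = b \<and>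
          class_map \<Sigma>' snd snd (Y_of \<G> ((rho r \<circ> \<pi>A \<circ> class_index) A)) A ` Y_of \<G> b = Z)"
  proof (intro ballI impI)
    fix V b Z
    assume "V \<in> verts Q" "b \<in> arcs \<Delta>" "head \<Delta> b = (\<pi>V \<circ> class_index) V" "Z \<in> adhesion_sets \<G> b"
    moreover from this(1) obtain s where "s \<in> verts T" "V = vclass s"
      by (auto simp: verts_quotient)
    ultimately show "\<exists>!A. A \<in> arcs Q \<and> head Q A = V \<and> (rho r \<circ> \<pi>A \<circ> class_index) A = b \<and>
          class_map \<Sigma>' snd snd (Y_of \<G> ((rho r \<circ> \<pi>A \<circ> class_index) A)) A ` Y_of \<G> b = Z"
      using ex1_arc_class[of s b Z] by (simp add: X_nonempty)
  qed
qed

end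

theorem lemma3p7:
  fixes \<G> :: "('v, 'a, 'g, 'x, 'h, 'y) action_graph"
    and N :: "'e set" and r :: "'e \<Rightarrow> 'a"
    and T :: "('tv, 'ta) rgraph"
    and \<pi>V :: "'tv \<Rightarrow> 'v" and \<pi>A :: "'ta \<Rightarrow> 'a + 'e"
    and \<beta> :: "'a + 'e \<Rightarrow> 'x set" and \<phi> :: "'e \<Rightarrow> 'y \<Rightarrow> 'x"
    and \<Sigma>' :: "('tv \<times> 'x, 'ta \<times> 'y) rgraph"
  assumes "graph_of_group_actions \<G>"
    and "canonical_data \<G> N r T \<pi>V \<pi>A \<beta> \<phi>"
    and "\<Sigma>' = canonical_graph \<G> r T \<pi>V \<pi>A \<phi>"
  shows "scaffolding \<G> \<Sigma>' (same_index (verts \<Sigma>')) (same_index (arcs \<Sigma>'))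
           (\<pi>V \<circ> class_index) (rho r \<circ> \<pi>A \<circ> class_index) snd snd"
proof -
  interpret canonical_construction \<G> N r T \<pi>V \<pi>A \<beta> \<phi>
    using assms(1,2) by unfold_locales
  show ?thesis
    unfolding assms(3) by (rule canonical_scaffolding)
qed

end
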